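(* Let $0\le n<m$ be integers and let $\tau_0,\tau_1,\dots,\tau_m$ be distinct nodes. The lifting matrix $\mathbf R_{n,m}$ of the Lagrange polynomial basis is given by $$\mathbf R_{n,m}=[\,\mathbf I_{n+1}\ |\ \mathbf K\,],$$ where $\mathbf I_{n+1}$ is the identity matrix of size $n+1$ and $\mathbf K$ is the $(n+1)\times(m-n)$ matrix with $$\mathbf K[i,j]=-\frac{w_{j+n,\,i-1}}{w_{j+n,\,j+n}}-\frac{1}{w_{j+n,\,j+n}}\sum_{r=1}^{j-1}w_{j+n,\,j+n-r}\,\mathbf K[i,j-r]$$ for $i=1,\dots,n+1$ and $j=1,\dots,m-n$.
   Context: For distinct nodes $\tau_0,\tau_1,\dots$ and $N\ge0$, the weights are $w_{N,j}=\prod_{s=0,\,s\ne j}^N\frac{1}{\tau_j-\tau_s}$, and the Lagrange basis of degree $N$ on $\tau_0,\dots,\tau_N$ is $L_{j,N}(x)=w_{N,j}\prod_{s=0,\,s\neq j}^N(x-\tau_s)$, $j=0,\dots,N$, with $\mathbf L_N(x)=[L_{0,N}(x),\dots,L_{N,N}(x)]^T$. For $N\ge1$, when the added node is the last one $\tau_N$, the one-step lifting matrix $\mathbf R_{N-1,N}$ is the $N\times(N+1)$ matrix with $\mathbf R_{N-1,N}[i,i]=1$ for $1\le i\le N$, $\mathbf R_{N-1,N}[i,N+1]=-\frac{w_{N,i-1}}{w_{N,N}}$, and $0$ elsewhere; it satisfies $\mathbf L_{N-1}(x)=\mathbf R_{N-1,N}\mathbf L_N(x)$. For $n<m$, the lifting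 matrix is the $(n+1)\times(m+1)$ matrix $\mathbf R_{n,m}=\mathbf R_{n,n+1}\mathbf R_{n+1,n+2}\cdots\mathbf R_{m-1,m}$ (at each step the added node is the last one). *)

theory Defs
  imports "Jordan_Normal_Form.Matrix"
begin

definition weight :: "(nat \<Rightarrow> 'a::field) \<Rightarrow> nat \<Rightarrow> nat \<Rightarrow> 'a" where
  "weight \<tau> N j = (\<Prod>s\<in>{0..N} - {j}. 1 / (\<tau> j - \<tau> s))"

text \<open>
  The one-step lifting matrix from degree \<open>N - 1\<close> to degree \<open>N\<close> (meant for \<open>N \<ge> 1\<close>), of size
  \<open>N \<times> (N + 1)\<close>. Matrix entries are indexed from 0, so the row \<open>i\<close> belongs to the basis
  polynomial with index \<open>i\<close> (one less than the usual row number), and the last column is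
  column \<open>N\<close>.
\<close>

definition lifting_step :: "(nat \<Rightarrow> 'a::field) \<Rightarrow> nat \<Rightarrow> 'a mat" where
  "lifting_step \<tau> N = mat N (N + 1)
     (\<lambda>(i, j). if j = i then 1
               else if j = N then - weight \<tau> N i / weight \<tau> N N
               else 0)"

text \<open>
  The product of the one-step matrices for \<open>N = n + 1, \<dots>, m\<close>, in this order from left to right
  (meant for \<open>n < m\<close>). The identity only serves as the starting value of the fold.
\<close>

definition lifting_matrix :: "(nat \<Rightarrow> 'a::field) \<Rightarrow> nat \<Rightarrow> nat \<Rightarrow> 'a mat" where
  "lifting_matrix \<tau> n m = foldl (\<lambda>A N. A * lifting_step \<tau> N) (1\<^sub>m (n + 1)) [n + 1..<m + 1]"

text \<open>
  The block matrix \<open>[A | B]\<close>, for \<open>A\<close> and \<open>B\<close> with the same number of rows; the column analogue of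
  \<^const>\<open>append_rows\<close>.
\<close>

definition append_cols :: "'a::zero mat \<Rightarrow> 'a mat \<Rightarrow> 'a mat" where
  "append_cols A B = four_block_mat A B (0\<^sub>m 0 (dim_col A)) (0\<^sub>m 0 (dim_col B))"

end

theory Submission
  imports Defs
begin

text \<open>
  Multiplying on the right by a one-step matrix keeps all columns and appends one new column, a
  combination of the old ones. So the columns of the lifting matrix never change once they are
  created: the first \<open>n + 1\<close> form the identity, and column \<open>N > n\<close> is the combination of the
  previous columns created at step \<open>N\<close>, which is the claimed recursion.
\<close>

lemma lifting_step_carrier [simp]: "lifting_step \<tau> N \<in> carrier_mat N (N + 1)"
  by (simp add: lifting_step_def)

lemma lifting_matrix_same [simp]: "lifting_matrix \<tau> n n = 1\<^sub>m (n + 1)"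
  by (simp add: lifting_matrix_def)

lemma lifting_matrix_Suc:
  "n \<le> m \<Longrightarrow> lifting_matrix \<tau> n (Suc m) = lifting_matrix \<tau> n m * lifting_step \<tau> (Suc m)"
  by (simp add: lifting_matrix_def)

lemma lifting_matrix_carrier:
  "n \<le> m \<Longrightarrow> lifting_matrix \<tau> n m \<in> carrier_mat (n + 1) (m + 1)"
proof (induction m rule: dec_induct)
  case (step m)
  then show ?case
    using lifting_step_carrier[of \<tau> "Suc m"] by (simp add: lifting_matrix_Suc)
qed simp

text \<open>For \<open>c < N\<close>, column \<open>c\<close> of the step matrix is the unit vector
  with its 1 in row \<open>c\<close>, so the product just picks out column \<open>c\<close> of
  \<open>A\<close>.\<close>

lemma mult_lifting_step_old_col:
  assumes "A \<in> carrier_mat k N" "i < k" "c < N"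
  shows "(A * lifting_step \<tau> N) $$ (i, c) = A $$ (i, c)"
proof -
  have "(A * lifting_step \<tau> N) $$ (i, c) = (\<Sum>l = 0..<N. A $$ (i, l) * (if l = c then 1 else 0))"
    using assms by (auto simp: lifting_step_def scalar_prod_def intro!: sum.cong)
  also have "\<dots> = A $$ (i, c)"
    using assms(3) by (simp add: if_distrib cong: if_cong)
  finally show ?thesis .
qed

text \<open>Row indices of the step matrix stay below \<open>N\<close>, so its column
  \<open>N\<close> has no diagonal entry and consists of weight quotients only.\<close>

lemma mult_lifting_step_new_col:
  assumes "A \<in> carrier_mat k N" "i < k"
  shows "(A * lifting_step \<tau> N) $$ (i, N) =
    - (\<Sum>c<N. weight \<tau> N c * A $$ (i, c)) / weight \<tau> N N"
proof -
  have "(A * lifting_step \<tau> N) $$ (i, N) =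
      (\<Sum>c = 0..<N. A $$ (i, c) * (- weight \<tau> N c / weight \<tau> N N))"
    using assms by (auto simp: lifting_step_def scalar_prod_def intro!: sum.cong)
  also have "\<dots> = - (\<Sum>c<N. weight \<tau> N c * A $$ (i, c)) / weight \<tau> N N"
    by (simp add: sum_divide_distrib sum_negf mult.commute atLeast0LessThan)
  finally show ?thesis .
qed

lemma lifting_matrix_stable:
  assumes "n \<le> k" "k \<le> m" "i \<le> n" "c \<le> k"
  shows "lifting_matrix \<tau> n m $$ (i, c) = lifting_matrix \<tau> n k $$ (i, c)"
  using assms(2)
proof (induction m rule: dec_induct)
  case (step m)
  have "lifting_matrix \<tau> n m \<in> carrier_mat (n + 1) (Suc m)"
    using lifting_matrix_carrier[of n m \<tau>] assms step.hyps by simp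
  from mult_lifting_step_old_col[OF this, of i c \<tau>] show ?case
    using assms step by (simp add: lifting_matrix_Suc)
qed simp

lemma lifting_matrix_identity_block:
  assumes "n \<le> m" "i \<le> n" "c \<le> n"
  shows "lifting_matrix \<tau> n m $$ (i, c) = (if c = i then 1 else 0)"
  using lifting_matrix_stable[of n n m i c \<tau>] assms by auto

text \<open>This is the claimed recursion in the column indices of the whole matrix; the main proof
  only reindexes it.\<close>

lemma lifting_matrix_recursion:
  assumes "n < N" "N \<le> m" "i \<le> n"
  shows "lifting_matrix \<tau> n m $$ (i, N) =
    - (weight \<tau> N i + (\<Sum>c\<in>{n<..<N}. weight \<tau> N c * lifting_matrix \<tau> n m $$ (i, c))) / weight \<tau> N N"
proof -
  obtain k where k: "N = Suc k" "n \<le> k"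
    using assms(1) by (cases N) auto
  let ?R = "\<lambda>c. lifting_matrix \<tau> n m $$ (i, c)"
  have carrier: "lifting_matrix \<tau> n k \<in> carrier_mat (n + 1) N"
    using lifting_matrix_carrier[OF k(2)] k(1) by simp
  \<comment> \<open>Cut the product off at \<open>N\<close>: there column \<open>N\<close> is the
    one that the last factor has just created.\<close>
  have "?R N = lifting_matrix \<tau> n N $$ (i, N)"
    using assms by (intro lifting_matrix_stable) auto
  also have "\<dots> = - (\<Sum>c<N. weight \<tau> N c * lifting_matrix \<tau> n k $$ (i, c)) / weight \<tau> N N"
    using mult_lifting_step_new_col[OF carrier, of i \<tau>] assms k
    by (simp add: lifting_matrix_Suc)
  \<comment> \<open>Every column \<open>c < N\<close> exists already at stage \<open>k\<close>, so
    stability leads back to the full matrix.\<close>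
  also have "(\<Sum>c<N. weight \<tau> N c * lifting_matrix \<tau> n k $$ (i, c)) = (\<Sum>c<N. weight \<tau> N c * ?R c)"
  proof (rule sum.cong)
    fix c assume "c \<in> {..<N}"
    then show "weight \<tau> N c * lifting_matrix \<tau> n k $$ (i, c) = weight \<tau> N c * ?R c"
      using lifting_matrix_stable[of n k m i c \<tau>] assms k by simp
  qed simp
  \<comment> \<open>In the identity block only \<open>c = i\<close> survives, which yields the
    inhomogeneous term \<open>weight \<tau> N i\<close>.\<close>
  also have "\<dots> = (\<Sum>c\<le>n. weight \<tau> N c * ?R c) + (\<Sum>c\<in>{n<..<N}. weight \<tau> N c * ?R c)"
    using assms(1) by (subst sum.union_disjoint[symmetric]) (auto intro!: sum.cong)
  also have "(\<Sum>c\<le>n. weight \<tau> N c * ?R c) = (\<Sum>c\<le>n. weight \<tau> N c * (if c = i then 1 else 0))"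
    using assms by (intro sum.cong) (simp_all add: lifting_matrix_identity_block)
  also have "\<dots> = weight \<tau> N i"
    using assms(3) by (simp add: if_distrib cong: if_cong)
  finally show ?thesis .
qed

theorem lemma5p4:
  fixes \<tau> :: "nat \<Rightarrow> 'a::field" and n m :: nat
  assumes "n < m" and "inj_on \<tau> {0..m}"
  shows "\<exists>K \<in> carrier_mat (n + 1) (m - n).
    lifting_matrix \<tau> n m = append_cols (1\<^sub>m (n + 1)) K \<and>
    (\<forall>i \<in> {1..n + 1}. \<forall>j \<in> {1..m - n}.
      K $$ (i - 1, j - 1) =
        - (weight \<tau> (j + n) (i - 1) / weight \<tau> (j + n) (j + n))
        - 1 / weight \<tau> (j + n) (j + n) *
            (\<Sum>r = 1..j - 1. weight \<tau> (j + n) (j + n - r) * K $$ (i - 1, j - r - 1)))"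
proof -
  let ?R = "lifting_matrix \<tau> n m"
  define K where "K = mat (n + 1) (m - n) (\<lambda>(i, j). ?R $$ (i, n + 1 + j))"
  have K: "K \<in> carrier_mat (n + 1) (m - n)"
    by (simp add: K_def)
  have "?R \<in> carrier_mat (n + 1) (m + 1)"
    using assms(1) by (intro lifting_matrix_carrier) simp
  then have "?R = append_cols (1\<^sub>m (n + 1)) K"
    using assms(1)
    by (intro eq_matI) (auto simp: append_cols_def K_def lifting_matrix_identity_block)
  moreover have "K $$ (i - 1, j - 1) =
        - (weight \<tau> (j + n) (i - 1) / weight \<tau> (j + n) (j + n))
        - 1 / weight \<tau> (j + n) (j + n) *
            (\<Sum>r = 1..j - 1. weight \<tau> (j + n) (j + n - r) * K $$ (i - 1, j - r - 1))"
    if i: "i \<in> {1..n + 1}" and j: "j \<in> {1..m - n}" for i j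
  proof -
    let ?N = "j + n"
    \<comment> \<open>The 1-based column \<open>l\<close> of \<open>K\<close> is the 0-based column
      \<open>(n + 1) + (l - 1) = l + n\<close> of \<open>?R\<close>; \<open>l \<ge> 1\<close> keeps
      the subtraction on naturals exact.\<close>
    have K_eq: "K $$ (i - 1, l - 1) = ?R $$ (i - 1, l + n)" if "l \<in> {1..m - n}" for l
      using i that by (auto simp: K_def add.commute)
    have "(\<Sum>c\<in>{n<..<?N}. weight \<tau> ?N c * ?R $$ (i - 1, c)) =
        (\<Sum>r = 1..j - 1. weight \<tau> ?N (?N - r) * ?R $$ (i - 1, ?N - r))"
      \<comment> \<open>The reflection \<open>c = ?N - r\<close> is its own inverse; since
        \<open>?N - n = j\<close>, the columns strictly between \<open>n\<close> and
        \<open>?N\<close> match \<open>r = 1, ..., j - 1\<close>.\<close>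
      by (rule sum.reindex_bij_witness[of _ "\<lambda>r. ?N - r" "\<lambda>c. ?N - c"]) auto
    also have "\<dots> = (\<Sum>r = 1..j - 1. weight \<tau> ?N (?N - r) * K $$ (i - 1, j - r - 1))"
    proof (rule sum.cong)
      fix r assume "r \<in> {1..j - 1}"
      then have "j - r \<in> {1..m - n}" "j - r + n = ?N - r"
        using j by auto
      then show "weight \<tau> ?N (?N - r) * ?R $$ (i - 1, ?N - r) =
          weight \<tau> ?N (?N - r) * K $$ (i - 1, j - r - 1)"
        using K_eq[of "j - r"] by simp
    qed simp
    finally show ?thesis
      using lifting_matrix_recursion[of n ?N m "i - 1" \<tau>] K_eq[OF j] i j
      by (auto simp: diff_divide_distrib)
  qed
  ultimately show ?thesis
    using K by blast
qed

end
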